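(* Let $G$ be a graph on $n$ vertices and let $A\in\mathcal{S}(G)$ have the strong spectral property (SSP). Then there is $\varepsilon>0$ such that for every $n\times n$ real symmetric matrix $M$ with $\|M-A\|<\varepsilon$, there exists a matrix $A'\in\mathcal{S}(G)$ with the SSP such that $\operatorname{spec}(A')=\operatorname{spec}(M)$ and $A'$ and $A$ have the same off-diagonal sign pattern (that is, for all $i\neq j$ the $i,j$-entries of $A'$ and of $A$ have the same sign).
   Context: All graphs are simple, finite and undirected. For a graph $G$ on $n$ vertices, $\mathcal{S}(G)$ is the set of $n\times n$ real symmetric matrices (indexed by $V(G)$) whose off-diagonal $i,j$-entry is nonzero if and only if $\{i,j\}$ is an edge of $G$; diagonal entries are arbitrary. $\operatorname{spec}(A)$ is the multiset of eigenvalues of $A$. A real symmetric matrix $A$ has the strong spectral property (SSP) if $X=O$ is the only real symmetric matrix with $A\circ X=O$, $I\circ X=O$ and $AX-XA=O$, where $\circ$ is the entrywise product. $\|\cdot\|$ is any fixed matrix norm. *)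

theory Defs
  imports "HOL-Analysis.Analysis" "HOL-Computational_Algebra.Polynomial"
begin

text \<open>
  The vertices of a graph are the elements of a finite type \<open>'n\<close>, and a graph is given by its
  set \<open>E\<close> of edges, an edge being a set of two distinct vertices.
\<close>

definition simple_graph :: "'n::finite set set \<Rightarrow> bool" where
  "simple_graph E \<longleftrightarrow> (\<forall>e\<in>E. card e = 2)"

definition symmetric_matrix :: "real^'n^'n \<Rightarrow> bool" where
  "symmetric_matrix A \<longleftrightarrow> transpose A = A"

definition graph_matrices :: "'n::finite set set \<Rightarrow> (real^'n^'n) set" where
  "graph_matrices E =
     {A. symmetric_matrix A \<and> (\<forall>i j. i \<noteq> j \<longrightarrow> (A $ i $ j \<noteq> 0 \<longleftrightarrow> {i, j} \<in> E))}"

definition entrywise_prod :: "real^'n^'n \<Rightarrow> real^'n^'n \<Rightarrow> real^'n^'n" where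
  "entrywise_prod A B = (\<chi> i j. A $ i $ j * B $ i $ j)"

definition SSP :: "real^'n^'n \<Rightarrow> bool" where
  "SSP A \<longleftrightarrow> symmetric_matrix A \<and>
     (\<forall>X. symmetric_matrix X \<and> entrywise_prod A X = 0 \<and> entrywise_prod (mat 1) X = 0 \<and>
          A ** X - X ** A = 0 \<longrightarrow> X = 0)"

definition charpoly :: "real^'n^'n \<Rightarrow> real poly" where
  "charpoly A = det (\<chi> i j. (if i = j then [:0, 1:] else 0) - [:A $ i $ j:])"

text \<open>
  The eigenvalues with their algebraic multiplicities. Only real roots of the characteristic
  polynomial are counted; for a symmetric matrix these are all its complex roots, and algebraic
  and geometric multiplicities agree.
\<close>

definition spec :: "real^'n^'n \<Rightarrow> real multiset" where
  "spec A = proots (charpoly A)"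

text \<open>
  A norm on the vector space of matrices; submultiplicativity is not required, so both the
  wide and the narrow meaning of ``matrix norm'' are covered.
\<close>

definition matrix_norm :: "(real^'n^'n \<Rightarrow> real) \<Rightarrow> bool" where
  "matrix_norm N \<longleftrightarrow>
     (\<forall>X. 0 \<le> N X) \<and> (\<forall>X. N X = 0 \<longleftrightarrow> X = 0) \<and>
     (\<forall>c X. N (c *\<^sub>R X) = \<bar>c\<bar> * N X) \<and> (\<forall>X Y. N (X + Y) \<le> N X + N Y)"

end

theory Submission
  imports Defs
begin

text \<open>
  The matrices to be found are those of the form \<open>A' = C M C\<^sup>T\<close> with \<open>C\<close> orthogonal and with the
  zero pattern of \<open>A\<close>. Equivalently, one has to solve \<open>C\<^sup>T A' C = M\<close> together with \<open>C\<^sup>T C = I\<close>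
  for \<open>A'\<close> in the linear space \<open>L\<close> of symmetric matrices that vanish at the off-diagonal zeros
  of \<open>A\<close>. Treating orthogonality of \<open>C\<close> as a second equation, instead of parametrizing the
  orthogonal group by exponentials or Cayley transforms, keeps the problem polynomial, and \<open>C\<close>
  ranges over a full matrix space. For \<open>M = A\<close> there is the solution \<open>A' = A\<close>, \<open>C = I\<close>.

  The linearization of the two left-hand sides at this solution sends \<open>(X, D)\<close>, with \<open>X\<close> in \<open>L\<close>,
  to \<open>(D\<^sup>T A + A D + X, D\<^sup>T + D)\<close>. Let a pair \<open>(Z, W)\<close> of symmetric matrices be orthogonal
  to its range. Varying \<open>X\<close> shows that \<open>Z\<close> vanishes on the diagonal and wherever \<open>A\<close> does not.
  Varying \<open>D\<close> gives \<open>A Z + W = 0\<close>, so that \<open>A Z\<close> is symmetric, which means that \<open>A\<close> and \<open>Z\<close>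
  commute. The SSP says precisely that then \<open>Z = 0\<close>, hence also \<open>W = 0\<close>. So the linearization is
  onto (\<open>surj_similarity_derivative\<close>), and a continuous map with a surjective derivative at
  a point is locally onto there: every symmetric \<open>M\<close> near \<open>A\<close> is reached with \<open>A'\<close> in any prescribed neighbourhood
  of \<open>A\<close>. To work with all matrices instead of symmetric ones, an extra skew-symmetric term is added
  to each equation; it vanishes automatically when the right-hand sides are symmetric.

  Two facts finish the proof. Nonzero entries of \<open>A\<close> keep their sign under small perturbations, and
  the SSP is an open condition on symmetric matrices (\<open>eventually_SSP\<close>), so \<open>A'\<close> has all required
  properties; and the characteristic polynomial is invariant under orthogonal similarity
  (\<open>charpoly_orthogonal_similar\<close>). The choice of norm is immaterial since any norm on matrices
  dominates a multiple of the Euclidean one.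
\<close>

section \<open>Matrix multiplication and the inner product of matrices\<close>

lemma bounded_bilinear_matrix_mult:
  "bounded_bilinear ((**) :: real^'n::finite^'m::finite \<Rightarrow> real^'p::finite^'n \<Rightarrow> real^'p^'m)"
  unfolding bilinear_conv_bounded_bilinear[symmetric] bilinear_def
  by (auto intro!: linearI simp: matrix_matrix_mult_def vec_eq_iff algebra_simps sum.distrib sum_distrib_left)

interpretation matrix_mult: bounded_bilinear
  "(**) :: real^'n::finite^'m::finite \<Rightarrow> real^'p::finite^'n \<Rightarrow> real^'p^'m"
  by (rule bounded_bilinear_matrix_mult)

lemma bounded_linear_transpose:
  "bounded_linear (transpose :: real^'n::finite^'m::finite \<Rightarrow> real^'m^'n)"
  unfolding linear_conv_bounded_linear[symmetric]
  by (auto intro!: linearI simp: transpose_def vec_eq_iff)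

lemmas linear_transpose = bounded_linear.linear[OF bounded_linear_transpose]

lemmas transpose_linear_simps =
  linear_0[OF linear_transpose] linear_add[OF linear_transpose] linear_diff[OF linear_transpose]
  linear_neg[OF linear_transpose] linear_cmul[OF linear_transpose]

text \<open>
  A matrix that is both symmetric and skew-symmetric is zero; here \<open>K - K\<^sup>T = S' - S\<close> is both.
\<close>

lemma symmetric_if_skew_difference:
  fixes S K S' :: "real^'n::finite^'n"
  assumes eq: "S + (K - transpose K) = S'" and "transpose S = S" "transpose S' = S'"
  shows "K = transpose K"
proof -
  have "S' = S + (transpose K - K)"
    using arg_cong[OF eq, of transpose]
    unfolding transpose_linear_simps transpose_transpose assms(2,3) by simp
  with eq have "2 *\<^sub>R (K - transpose K) = 0"
    by (simp add: scaleR_2)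
  then show ?thesis by simp
qed

lemma inner_transpose_left:
  fixes X :: "real^'n::finite^'m::finite"
  shows "transpose X \<bullet> Y = X \<bullet> transpose Y"
  by (simp add: inner_vec_def transpose_def) (rule sum.swap)

lemma inner_matrix_mult_left:
  fixes A :: "real^'n::finite^'m::finite" and X :: "real^'p::finite^'n"
  shows "(A ** X) \<bullet> Z = X \<bullet> (transpose A ** Z)"
proof -
  have "(A ** X) \<bullet> Z = (\<Sum>i\<in>UNIV. \<Sum>j\<in>UNIV. \<Sum>k\<in>UNIV. A$i$k * X$k$j * Z$i$j)"
    by (simp add: inner_vec_def matrix_matrix_mult_def sum_distrib_right)
  also have "\<dots> = (\<Sum>i\<in>UNIV. \<Sum>k\<in>UNIV. \<Sum>j\<in>UNIV. A$i$k * X$k$j * Z$i$j)"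
    by (intro sum.cong refl sum.swap)
  also have "\<dots> = (\<Sum>k\<in>UNIV. \<Sum>i\<in>UNIV. \<Sum>j\<in>UNIV. A$i$k * X$k$j * Z$i$j)"
    by (rule sum.swap)
  also have "\<dots> = (\<Sum>k\<in>UNIV. \<Sum>j\<in>UNIV. \<Sum>i\<in>UNIV. A$i$k * X$k$j * Z$i$j)"
    by (intro sum.cong refl sum.swap)
  also have "\<dots> = X \<bullet> (transpose A ** Z)"
    by (simp add: inner_vec_def matrix_matrix_mult_def transpose_def sum_distrib_left mult_ac)
  finally show ?thesis .
qed

section \<open>Surjectivity of linear maps and comparison of norms\<close>

lemma linear_surjI_orthogonal:
  fixes f :: "'a::euclidean_space \<Rightarrow> 'b::euclidean_space"
  assumes f: "linear f"
    and orth: "\<And>z. (\<And>x. f x \<bullet> z = 0) \<Longrightarrow> z = 0"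
  shows "surj f"
proof (rule ccontr)
  assume "\<not> surj f"
  moreover have "subspace (range f)"
    using f by (simp add: linear_subspace_image)
  ultimately have "span (range f) \<subset> span UNIV"
    by (metis span_UNIV span_eq_iff top.not_eq_extremum)
  then obtain z where "z \<noteq> 0" and z: "\<And>y. y \<in> span (range f) \<Longrightarrow> orthogonal z y"
    using orthogonal_to_subspace_exists_gen by blast
  have "f x \<bullet> z = 0" for x
    using z[of "f x"] by (simp add: span_base orthogonal_def inner_commute)
  with orth \<open>z \<noteq> 0\<close> show False by blast
qed

text \<open>
  A norm is convex, hence continuous, and therefore attains a positive minimum on the Euclidean unit
  sphere. Homogeneity turns this minimum into the constant.
\<close>

lemma matrix_norm_dominates_norm:
  fixes N :: "real^'n::finite^'n \<Rightarrow> real"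
  assumes "matrix_norm N"
  shows "\<exists>c>0. \<forall>X. c * norm X \<le> N X"
proof -
  have nonneg: "\<And>X. 0 \<le> N X" and zero: "\<And>X. N X = 0 \<longleftrightarrow> X = 0"
    and scale: "\<And>c X. N (c *\<^sub>R X) = \<bar>c\<bar> * N X" and triangle: "\<And>X Y. N (X + Y) \<le> N X + N Y"
    using assms by (auto simp: matrix_norm_def)
  have "convex_on UNIV N"
  proof (intro convex_onI)
    fix t :: real and X Y :: "real^'n^'n"
    assume "0 < t" "t < 1"
    then show "N ((1 - t) *\<^sub>R X + t *\<^sub>R Y) \<le> (1 - t) * N X + t * N Y"
      using triangle[of "(1 - t) *\<^sub>R X" "t *\<^sub>R Y"] by (simp add: scale)
  qed simp
  then have "continuous_on UNIV N"
    by (intro convex_on_continuous) auto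
  then have "continuous_on (sphere 0 1) N"
    using continuous_on_subset by blast
  moreover obtain U :: "real^'n^'n" where U: "norm U = 1"
    using vector_choose_size[of 1] by auto
  ultimately obtain V where V: "norm V = 1" and min: "\<And>X. norm X = 1 \<Longrightarrow> N V \<le> N X"
    using continuous_attains_inf[of "sphere 0 1" N] compact_sphere
    by (metis dist_0_norm empty_iff mem_sphere)
  have "N V > 0"
    using V nonneg[of V] zero[of V] by (cases "V = 0") auto
  moreover have "N V * norm X \<le> N X" for X
  proof (cases "X = 0")
    case False
    then have "N V \<le> N ((1 / norm X) *\<^sub>R X)"
      by (intro min) simp
    also have "\<dots> = N X / norm X"
      by (simp add: scale)
    finally show ?thesis
      using False by (simp add: field_simps)
  qed (simp add: nonneg)
  ultimately show ?thesis by blast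
qed

section \<open>Orthogonal similarity\<close>

lemma poly_charpoly: "poly (charpoly A) x = det (mat x - A)"
  by (simp add: charpoly_def det_def poly_sum poly_prod mat_def if_distrib[of poly] if_distribR cong: if_cong)

text \<open>
  Two real polynomials with the same values are equal, so it is enough to compare determinants of
  real matrices, where multiplicativity applies to \<open>C\<^sup>T (x I - B) C\<close>.
\<close>

lemma charpoly_orthogonal_similar:
  fixes B C :: "real^'n::finite^'n"
  assumes "transpose C ** C = mat 1"
  shows "charpoly (transpose C ** B ** C) = charpoly B"
proof -
  have "det (mat x - transpose C ** B ** C) = det (mat x - B)" for x
  proof -
    have "transpose C ** mat x ** C = mat x"
    proof -
      have "mat x = x *\<^sub>R (mat 1 :: real^'n^'n)"
        by (simp add: mat_def vec_eq_iff)
      then show ?thesis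
        using assms by (simp add: matrix_mult.scaleR_left matrix_mult.scaleR_right)
    qed
    then have "mat x - transpose C ** B ** C = transpose C ** (mat x - B) ** C"
      by (simp add: matrix_mult.diff_left matrix_mult.diff_right)
    then have "det (mat x - transpose C ** B ** C) = det (transpose C ** C) * det (mat x - B)"
      by (simp add: det_mul)
    then show ?thesis
      using assms by simp
  qed
  then have "poly (charpoly (transpose C ** B ** C)) = poly (charpoly B)"
    by (intro ext) (simp add: poly_charpoly)
  then show ?thesis
    by (simp add: poly_eq_poly_eq_iff)
qed

section \<open>Conditions that persist near a matrix\<close>

lemma eventually_nonzero_entries_keep_sign:
  fixes A :: "real^'n::finite^'m::finite"
  shows "\<forall>\<^sub>F B in nhds A. \<forall>i j. A $ i $ j \<noteq> 0 \<longrightarrow> sgn (B $ i $ j) = sgn (A $ i $ j)"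
proof (intro eventually_all_finite)
  fix i j
  have lim: "((\<lambda>B. B $ i $ j) \<longlongrightarrow> A $ i $ j) (nhds A)"
    by (intro tendsto_vec_nth filterlim_ident)
  consider "A $ i $ j = 0" | "A $ i $ j > 0" | "A $ i $ j < 0" by linarith
  then show "\<forall>\<^sub>F B in nhds A. A $ i $ j \<noteq> 0 \<longrightarrow> sgn (B $ i $ j) = sgn (A $ i $ j)"
  proof cases
    case 2
    then show ?thesis
      using order_tendstoD(1)[OF lim 2] by (auto elim: eventually_mono)
  next
    case 3
    then show ?thesis
      using order_tendstoD(2)[OF lim 3] by (auto elim: eventually_mono)
  qed simp
qed

lemma SSP_iff:
  "SSP A \<longleftrightarrow> transpose A = A \<and>
     (\<forall>X. transpose X = X \<and> (\<forall>i j. i = j \<or> A $ i $ j \<noteq> 0 \<longrightarrow> X $ i $ j = 0) \<and> A ** X = X ** A \<longrightarrow> X = 0)"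
proof -
  have "entrywise_prod A X = 0 \<and> entrywise_prod (mat 1) X = 0 \<longleftrightarrow>
      (\<forall>i j. i = j \<or> A $ i $ j \<noteq> 0 \<longrightarrow> X $ i $ j = 0)" for X
    by (auto simp: entrywise_prod_def vec_eq_iff mat_def)
  then show ?thesis
    unfolding SSP_def symmetric_matrix_def right_minus_eq by blast
qed

text \<open>
  On the space \<open>S\<close> of symmetric \<open>X\<close> that vanish on the diagonal and on the support of \<open>A\<close>, the map
  \<open>X \<mapsto> A X - X A\<close> is injective by the SSP, hence bounded below by some \<open>e \<parallel>X\<parallel>\<close>. For \<open>B\<close> near \<open>A\<close>
  the support can only grow, so every \<open>X\<close> to be tested for \<open>B\<close> lies in \<open>S\<close>, and if \<open>X\<close> commutes with \<open>B\<close>,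
  then \<open>A X - X A\<close> is too small compared with \<open>X\<close> unless \<open>X = 0\<close>.
\<close>

lemma eventually_SSP:
  fixes A :: "real^'n::finite^'n"
  assumes "SSP A"
  shows "\<forall>\<^sub>F B in nhds A. transpose B = B \<longrightarrow> SSP B"
proof -
  define S :: "(real^'n^'n) set" where
    "S = {X. transpose X = X \<and> (\<forall>i j. i = j \<or> A $ i $ j \<noteq> 0 \<longrightarrow> X $ i $ j = 0)}"
  have "subspace S"
    by (auto simp: S_def subspace_def transpose_linear_simps)
  moreover have "bounded_linear (\<lambda>X. A ** X - X ** A)"
    by (intro bounded_linear_sub matrix_mult.bounded_linear_left matrix_mult.bounded_linear_right)
  moreover have "\<forall>X\<in>S. A ** X - X ** A = 0 \<longrightarrow> X = 0"
    using assms by (auto simp: SSP_iff S_def)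
  ultimately obtain e where "e > 0" and e: "\<And>X. X \<in> S \<Longrightarrow> e * norm X \<le> norm (A ** X - X ** A)"
    using injective_imp_isometric[of S "\<lambda>X. A ** X - X ** A"] closed_subspace by blast
  obtain K where "K > 0" and K: "\<And>(X :: real^'n^'n) (Y :: real^'n^'n). norm (X ** Y) \<le> norm X * norm Y * K"
    using matrix_mult.pos_bounded by blast
  have "\<forall>\<^sub>F B in nhds A. dist B A < e / (2 * K)"
    using \<open>e > 0\<close> \<open>K > 0\<close> eventually_nhds_ball[of "e / (2 * K)" A]
    by (simp add: dist_commute)
  moreover note eventually_nonzero_entries_keep_sign[of A]
  ultimately show ?thesis
  proof eventually_elim
    case (elim B)
    show ?case
    proof
      assume "transpose B = B"
      moreover have "X = 0" if X: "transpose X = X"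
        "\<forall>i j. i = j \<or> B $ i $ j \<noteq> 0 \<longrightarrow> X $ i $ j = 0" "B ** X = X ** B" for X
      proof (rule ccontr)
        assume "X \<noteq> 0"
        have "X \<in> S"
          using X elim(2) by (auto simp: S_def) (metis sgn_0_0)
        then have "e * norm X \<le> norm (A ** X - X ** A)"
          by (rule e)
        also have "A ** X - X ** A = (A - B) ** X - X ** (A - B)"
          using X(3) by (simp add: matrix_mult.diff_left matrix_mult.diff_right)
        also have "norm \<dots> \<le> norm (A - B) * norm X * K + norm X * norm (A - B) * K"
          by (intro order_trans[OF norm_triangle_ineq4] add_mono K)
        also have "\<dots> = 2 * K * dist B A * norm X"
          by (simp add: dist_norm norm_minus_commute)
        also have "\<dots> < e * norm X"
          using elim(1) \<open>X \<noteq> 0\<close> \<open>K > 0\<close> by (simp add: field_simps)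
        finally show False by simp
      qed
      ultimately show "SSP B"
        by (auto simp: SSP_iff)
    qed
  qed
qed

section \<open>The isospectral equations and their linearization\<close>

text \<open>
  This parametrizes, by arbitrary matrices \<open>X\<close>, the symmetric matrices supported on the diagonal and on
  the support of a symmetric matrix \<open>A\<close>. It doubles symmetric \<open>X\<close> of that kind, and it kills
  skew-symmetric ones.
\<close>

definition pattern_part :: "real^'n^'n \<Rightarrow> real^'n^'n \<Rightarrow> real^'n^'n" where
  "pattern_part A X = (\<chi> i j. if i = j \<or> A $ i $ j \<noteq> 0 then X $ i $ j + X $ j $ i else 0)"

lemma bounded_linear_pattern_part:
  fixes A :: "real^'n::finite^'n"
  shows "bounded_linear (pattern_part A)"
  unfolding linear_conv_bounded_linear[symmetric]
  by (auto intro!: linearI simp: pattern_part_def vec_eq_iff algebra_simps)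

lemma pattern_part_0: "pattern_part A 0 = 0"
  by (simp add: pattern_part_def vec_eq_iff)

lemma symmetric_pattern_part:
  assumes "transpose A = A"
  shows "transpose (pattern_part A X) = pattern_part A X"
proof -
  have "A $ i $ j = A $ j $ i" for i j
    using assms by (metis transpose_def vec_lambda_beta)
  then show ?thesis
    by (auto simp: transpose_def pattern_part_def vec_eq_iff)
qed

text \<open>
  For symmetric \<open>X\<close> and \<open>Y\<close> the value \<open>(M, I)\<close> is taken exactly if \<open>C\<^sup>T A' C = M\<close> and \<open>C\<^sup>T C = I\<close>, where
  \<open>A' = A + pattern_part A X\<close>. The skew-symmetric summands \<open>X - X\<^sup>T\<close> and \<open>Y - Y\<^sup>T\<close> make it possible
  to reach non-symmetric pairs as well, so that the derivative can be onto the full space.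
\<close>

definition similarity_map ::
  "real^'n^'n \<Rightarrow> (real^'n^'n) \<times> (real^'n^'n) \<times> (real^'n^'n) \<Rightarrow> (real^'n^'n) \<times> (real^'n^'n)" where
  "similarity_map A = (\<lambda>(X, C, Y).
     (transpose C ** (A + pattern_part A X) ** C + (X - transpose X),
      transpose C ** C + (Y - transpose Y)))"

definition similarity_derivative ::
  "real^'n^'n \<Rightarrow> (real^'n^'n) \<times> (real^'n^'n) \<times> (real^'n^'n) \<Rightarrow> (real^'n^'n) \<times> (real^'n^'n)" where
  "similarity_derivative A = (\<lambda>(X, D, Y).
     (transpose D ** A + A ** D + pattern_part A X + (X - transpose X),
      transpose D + D + (Y - transpose Y)))"

lemma similarity_map_has_derivative:
  fixes A :: "real^'n::finite^'n"
  shows "(similarity_map A has_derivative similarity_derivative A) (at (0, mat 1, 0))"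
proof -
  let ?F = "at (0, mat 1, 0) :: ((real^'n^'n) \<times> (real^'n^'n) \<times> (real^'n^'n)) filter"
  have X: "(fst has_derivative fst) ?F"
    and C: "((\<lambda>x. fst (snd x)) has_derivative (\<lambda>x. fst (snd x))) ?F"
    and Y: "((\<lambda>x. snd (snd x)) has_derivative (\<lambda>x. snd (snd x))) ?F"
    by (auto intro!: derivative_eq_intros)
  note transpose = bounded_linear.has_derivative[OF bounded_linear_transpose]
  have B: "((\<lambda>x. A + pattern_part A (fst x)) has_derivative (\<lambda>x. 0 + pattern_part A (fst x))) ?F"
    by (intro has_derivative_add has_derivative_const X
        bounded_linear.has_derivative[OF bounded_linear_pattern_part])
  have "((\<lambda>x. (transpose (fst (snd x)) ** (A + pattern_part A (fst x)) ** fst (snd x)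
           + (fst x - transpose (fst x)),
         transpose (fst (snd x)) ** fst (snd x) + (snd (snd x) - transpose (snd (snd x)))))
      has_derivative similarity_derivative A) ?F"
    by (rule has_derivative_eq_rhs, rule has_derivative_Pair[OF
          has_derivative_add[OF matrix_mult.FDERIV[OF matrix_mult.FDERIV[OF transpose[OF C] B] C]
            has_derivative_diff[OF X transpose[OF X]]]
          has_derivative_add[OF matrix_mult.FDERIV[OF transpose[OF C] C]
            has_derivative_diff[OF Y transpose[OF Y]]]])
      (simp add: fun_eq_iff similarity_derivative_def case_prod_beta algebra_simps
        pattern_part_0)
  then show ?thesis
    unfolding similarity_map_def case_prod_beta .
qed

lemma continuous_on_similarity_map:
  fixes A :: "real^'n::finite^'n"
  shows "continuous_on UNIV (similarity_map A)"
  unfolding similarity_map_def case_prod_beta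
  by (intro continuous_intros matrix_mult.continuous_on bounded_linear.continuous_on[OF bounded_linear_transpose]
      bounded_linear.continuous_on[OF bounded_linear_pattern_part])

text \<open>
  This is where the SSP enters: a pair \<open>(Z, W)\<close> orthogonal to the range consists of symmetric matrices
  because of the skew-symmetric summands, and then \<open>Z\<close> is exactly a test matrix for the SSP of \<open>A\<close>.
\<close>

lemma surj_similarity_derivative:
  fixes A :: "real^'n::finite^'n"
  assumes "SSP A"
  shows "surj (similarity_derivative A)"
proof (rule linear_surjI_orthogonal)
  show "linear (similarity_derivative A)"
    using similarity_map_has_derivative has_derivative_bounded_linear bounded_linear.linear by blast
next
  fix p :: "(real^'n^'n) \<times> (real^'n^'n)"
  assume orth: "\<And>x. similarity_derivative A x \<bullet> p = 0"
  obtain Z W where p: "p = (Z, W)" by (cases p)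
  have A: "transpose A = A"
    using assms by (simp add: SSP_iff)
  \<comment> \<open>It is enough to test against the skew-symmetric part of \<open>V\<close>, since then that part is orthogonal to
      itself. The premise is the form in which \<open>X - X\<^sup>T\<close> occurs in the derivative, for \<open>X = V - V\<^sup>T\<close>.\<close>
  have sym: "V = transpose V" if "(V - transpose V - transpose (V - transpose V)) \<bullet> V = 0"
    for V :: "real^'n^'n"
  proof -
    define K where "K = V - transpose V"
    have K: "transpose K = - K"
      by (simp add: K_def transpose_linear_simps)
    with that have "(K + K) \<bullet> V = 0"
      unfolding K_def[symmetric] by (metis diff_minus_eq_add)
    then have "K \<bullet> V = 0"
      unfolding inner_add_left by simp
    moreover have "K \<bullet> transpose V = - (K \<bullet> V)"
      using K by (metis inner_transpose_left inner_minus_left)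
    ultimately have "K \<bullet> K = 0"
      by (simp add: K_def inner_diff_right)
    then have "K = 0" by simp
    then show ?thesis by (simp add: K_def)
  qed
  have W: "W = transpose W"
    using orth[of "(0, 0, W - transpose W)"]
    by (intro sym) (simp add: p similarity_derivative_def pattern_part_0 transpose_linear_simps)
  have X: "pattern_part A X \<bullet> Z + (X - transpose X) \<bullet> Z = 0" for X
    using orth[of "(X, 0, 0)"]
    by (simp add: p similarity_derivative_def transpose_linear_simps inner_add_left)
  have Z: "Z = transpose Z"
  proof (rule sym)
    have "pattern_part A (Z - transpose Z) = 0"
      by (simp add: pattern_part_def vec_eq_iff transpose_def)
    with X[of "Z - transpose Z"]
    show "(Z - transpose Z - transpose (Z - transpose Z)) \<bullet> Z = 0"
      by simp
  qed
  have Z_entry: "Z $ i $ j = Z $ j $ i" for i j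
    using Z by (metis transpose_def vec_lambda_beta)
  have "pattern_part A Z \<bullet> Z = 0"
    using X[of Z] Z by simp
  moreover have "pattern_part A Z \<bullet> pattern_part A Z = 2 * (pattern_part A Z \<bullet> Z)"
    unfolding inner_vec_def sum_distrib_left
    by (intro sum.cong refl) (auto simp: pattern_part_def Z_entry)
  ultimately have "pattern_part A Z = 0"
    by simp
  then have pattern: "\<forall>i j. i = j \<or> A $ i $ j \<noteq> 0 \<longrightarrow> Z $ i $ j = 0"
    by (auto simp: pattern_part_def vec_eq_iff Z_entry split: if_splits)
  have "(A ** Z + W) \<bullet> D = 0" for D
  proof -
    have "transpose D ** A = transpose (A ** D)"
      by (simp add: matrix_transpose_mul A)
    then have "(transpose D ** A) \<bullet> Z = (A ** D) \<bullet> Z"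
      using Z by (simp add: inner_transpose_left)
    moreover have "(A ** D) \<bullet> Z = (A ** Z) \<bullet> D"
      using inner_matrix_mult_left[of A D Z] by (simp add: A inner_commute)
    moreover have "transpose D \<bullet> W = W \<bullet> D"
      using W inner_transpose_left[of D W] by (metis inner_commute)
    ultimately show ?thesis
      using orth[of "(0, D, 0)"]
      by (simp add: p similarity_derivative_def pattern_part_0 transpose_linear_simps inner_add_left inner_commute[of D W])
  qed
  then have AZ: "A ** Z + W = 0"
    using inner_eq_zero_iff by blast
  \<comment> \<open>Transposing, and using that all three matrices are symmetric, shows that \<open>A\<close> and \<open>Z\<close> commute.\<close>
  then have "transpose (A ** Z + W) = 0"
    by (simp add: transpose_linear_simps)
  then have "Z ** A + W = 0"
    using A Z[symmetric] W[symmetric] by (simp add: transpose_linear_simps matrix_transpose_mul)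
  then have "A ** Z = Z ** A"
    using AZ by (metis add_right_cancel)
  then have "Z = 0"
    using assms Z pattern by (auto simp: SSP_iff)
  with AZ show "p = 0"
    by (simp add: p zero_prod_def)
qed

theorem theorem3p11:
  fixes E :: "'n::finite set set"
    and A :: "real^'n^'n"
    and N :: "real^'n^'n \<Rightarrow> real"
  assumes "simple_graph E"
    and "matrix_norm N"
    and "A \<in> graph_matrices E"
    and "SSP A"
  shows "\<exists>\<epsilon>>0. \<forall>M. symmetric_matrix M \<and> N (M - A) < \<epsilon> \<longrightarrow>
           (\<exists>A'. A' \<in> graph_matrices E \<and> SSP A' \<and> spec A' = spec M \<and>
                 (\<forall>i j. i \<noteq> j \<longrightarrow> sgn (A' $ i $ j) = sgn (A $ i $ j)))"
proof -
  have symA: "transpose A = A"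
    using assms(4) by (simp add: SSP_iff)
  have "\<forall>\<^sub>F B in nhds A. (transpose B = B \<longrightarrow> SSP B) \<and>
      (\<forall>i j. A $ i $ j \<noteq> 0 \<longrightarrow> sgn (B $ i $ j) = sgn (A $ i $ j))"
    by (intro eventually_conj eventually_SSP[OF assms(4)] eventually_nonzero_entries_keep_sign)
  then obtain U where "open U" "A \<in> U" and U: "\<And>B. B \<in> U \<Longrightarrow> transpose B = B \<Longrightarrow> SSP B"
      "\<And>B i j. B \<in> U \<Longrightarrow> A $ i $ j \<noteq> 0 \<Longrightarrow> sgn (B $ i $ j) = sgn (A $ i $ j)"
    unfolding eventually_nhds by blast
  \<comment> \<open>Only the parameter \<open>X\<close> has to be kept small: it determines \<open>A'\<close>, while \<open>C\<close> and \<open>Y\<close> are discarded.\<close>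
  define T :: "((real^'n^'n) \<times> (real^'n^'n) \<times> (real^'n^'n)) set" where
    "T = (\<lambda>p. A + pattern_part A (fst p)) -` U"
  have "open T"
    unfolding T_def using \<open>open U\<close>
    by (intro open_vimage continuous_intros bounded_linear.continuous_on[OF bounded_linear_pattern_part])
  moreover have "(0, mat 1, 0) \<in> T"
    using \<open>A \<in> U\<close> by (simp add: T_def pattern_part_0)
  ultimately have T: "(0, mat 1, 0) \<in> interior T"
    by (simp add: interior_open)
  obtain g where "linear g" "similarity_derivative A \<circ> g = id"
    using linear_surjective_right_inverse surj_similarity_derivative[OF assms(4)]
      has_derivative_bounded_linear[OF similarity_map_has_derivative] bounded_linear.linear
    by blast
  then have "similarity_map A (0, mat 1, 0) \<in> interior (similarity_map A ` T)"
    using T continuous_on_similarity_map similarity_map_has_derivative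
    by (intro sussmann_open_mapping[where S=UNIV and f'="similarity_derivative A" and g'=g])
      (auto simp: linear_conv_bounded_linear)
  moreover have "similarity_map A (0, mat 1, 0) = (A, mat 1)"
    by (simp add: similarity_map_def pattern_part_0 transpose_linear_simps)
  ultimately obtain r where "r > 0" and r: "ball (A, mat 1) r \<subseteq> similarity_map A ` T"
    by (auto simp: mem_interior)
  obtain c where "c > 0" and c: "\<And>X. c * norm X \<le> N X"
    using matrix_norm_dominates_norm[OF assms(2)] by blast
  show ?thesis
  proof (intro exI[of _ "c * r"] conjI allI impI)
    show "c * r > 0" using \<open>c > 0\<close> \<open>r > 0\<close> by simp
  next
    fix M assume M: "symmetric_matrix M \<and> N (M - A) < c * r"
    then have "norm (M - A) < r"
      using c[of "M - A"] \<open>c > 0\<close> by (metis mult_less_cancel_left_pos order_le_less_trans)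
    then have "(M, mat 1) \<in> ball (A, mat 1) r"
      by (simp add: dist_Pair_Pair dist_norm norm_minus_commute)
    then obtain X C Y where "(X, C, Y) \<in> T" and
      *: "similarity_map A (X, C, Y) = (M, mat 1)"
      using r by (metis (no_types, lifting) imageE prod.collapse subsetD)
    define B where "B = A + pattern_part A X"
    have BU: "B \<in> U" using \<open>(X, C, Y) \<in> T\<close> by (simp add: T_def B_def)
    have symB: "transpose B = B"
      using symA by (simp add: B_def symmetric_pattern_part transpose_linear_simps)
    have eqs: "transpose C ** B ** C + (X - transpose X) = M"
      "transpose C ** C + (Y - transpose Y) = mat 1"
      using * by (auto simp: similarity_map_def B_def)
    have "X = transpose X"
      using eqs(1) by (rule symmetric_if_skew_difference)
        (use M symB in \<open>simp_all add: matrix_transpose_mul matrix_mul_assoc symmetric_matrix_def\<close>)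
    then have CBC: "transpose C ** B ** C = M" using eqs(1) by simp
    have "Y = transpose Y"
      using eqs(2) by (rule symmetric_if_skew_difference) (simp_all add: matrix_transpose_mul)
    then have CC: "transpose C ** C = mat 1" using eqs(2) by simp
    have sgn: "sgn (B $ i $ j) = sgn (A $ i $ j)" if "i \<noteq> j" for i j
      using U(2)[OF BU, of i j] that by (cases "A $ i $ j = 0") (auto simp: B_def pattern_part_def)
    have "B \<in> graph_matrices E"
      using assms(3) symB sgn by (auto simp: graph_matrices_def symmetric_matrix_def) (metis sgn_0_0)+
    moreover have "spec B = spec M"
      using charpoly_orthogonal_similar[OF CC, of B] CBC by (simp add: spec_def)
    ultimately show "\<exists>A'. A' \<in> graph_matrices E \<and> SSP A' \<and> spec A' = spec M \<and>
                 (\<forall>i j. i \<noteq> j \<longrightarrow> sgn (A' $ i $ j) = sgn (A $ i $ j))"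
      using U(1)[OF BU] symB sgn by (auto simp: symmetric_matrix_def)
  qed
qed

end
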